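(* There is no non-trivial cycle of length $6$.
   Context: The subprime Fibonacci rule: from positive integers $x,y$ with $s=x+y$, the next term is $s$ if $s$ is prime and $s/p$ if $s$ is composite, where $p$ is the smallest prime factor of $s$. A non-trivial cycle of length $m$ is an $m$-tuple $(t_1,\dots,t_m)$ of positive integers, indices read modulo $m$, such that for every $i$, $t_i$ is obtained from $t_{i-2},t_{i-1}$ by this rule, the $t_i$ are not all equal, and $m$ is the minimal period; equivalently it is the repeating block of an eventually periodic, not eventually constant, subprime Fibonacci sequence. *)

theory Defs
  imports "HOL-Computational_Algebra.Primes"
begin

text \<open>Only meaningful for \<open>s \<ge> 2\<close>, which is the case for every sum of two positive integers.\<close>

definition smallest_prime_factor :: "nat \<Rightarrow> nat" where
  "smallest_prime_factor s = (LEAST p. prime p \<and> p dvd s)"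

text \<open>For positive \<open>x\<close> and \<open>y\<close> the sum is at least \<open>2\<close>, so the second branch is exactly
  the composite case, and the division there is exact.\<close>

definition subprime_next :: "nat \<Rightarrow> nat \<Rightarrow> nat" where
  "subprime_next x y =
    (let s = x + y in if prime s then s else s div smallest_prime_factor s)"

text \<open>The tuple \<open>(t\<^sub>1, \<dots>, t\<^sub>m)\<close> is the list \<open>t\<close>, indexed from \<open>0\<close> and
  read cyclically. The recurrence is shifted by two so that no index is subtracted.
  The last conjunct says that no positive \<open>d < m\<close> is a period.\<close>

definition nontrivial_subprime_cycle :: "nat \<Rightarrow> nat list \<Rightarrow> bool" where
  "nontrivial_subprime_cycle m t \<longleftrightarrow>
     m > 0 \<and> length t = m \<and>
     (\<forall>x\<in>set t. x > 0) \<and>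
     (\<forall>i. t ! ((i + 2) mod m) = subprime_next (t ! (i mod m)) (t ! ((i + 1) mod m))) \<and>
     (\<exists>x\<in>set t. \<exists>y\<in>set t. x \<noteq> y) \<and>
     (\<forall>d. 0 < d \<and> d < m \<longrightarrow> \<not> (\<forall>i. t ! ((i + d) mod m) = t ! (i mod m)))"

end

theory Submission
  imports Defs
begin

text \<open>Write the rule as \<open>p z = x + y\<close>, where \<open>p = 1\<close> and \<open>z\<close> is prime, or \<open>p\<close> is the smallest prime
  factor of \<open>x + y\<close> and \<open>p \<le> z\<close>; in particular all terms of a cycle are at least \<open>2\<close>.
  If all terms have the same parity, all quotients \<open>p\<close> are \<open>2\<close> and the cycle is constant.
  Otherwise every even term is followed by two odd ones, so up to rotation the quotients
  are \<open>(p, 2, 2, 2, 2, q)\<close> or \<open>(p, 2, q, r, 2, s)\<close> with \<open>p, q, r, s\<close> odd. A positive solution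
  of the cyclic linear system exists only if its determinant vanishes. In the first case
  this reads \<open>(16p - 11)(16q - 11) = 441\<close>, which is impossible; in the second it forces one
  quotient to be \<open>1\<close> and leaves finitely many quadruples, excluded one by one.\<close>

section \<open>The rule as a linear equation with a quotient\<close>

text \<open>The value \<open>p = 1\<close> marks a prime sum, so both branches of the rule share one
  linear equation; in the second branch \<open>p \<le> z\<close> makes the sum composite.\<close>

definition subprime_step :: "nat \<Rightarrow> nat \<Rightarrow> nat \<Rightarrow> nat \<Rightarrow> bool" where
  "subprime_step p x y z \<longleftrightarrow> p * z = x + y \<and>
     (p = 1 \<and> prime z \<or> prime p \<and> p \<le> z \<and> (\<forall>d. prime d \<longrightarrow> d dvd x + y \<longrightarrow> p \<le> d))"

text \<open>If the sum \<open>p * z\<close> is composite, then \<open>z > 1\<close>, and every prime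
  factor \<open>d\<close> of \<open>z\<close> divides the sum, whence
  \<open>p \<le> d \<le> z\<close>.\<close>

lemma subprime_step_subprime_next:
  assumes "x > 0" "y > 0"
  shows "\<exists>p. subprime_step p x y (subprime_next x y)"
proof (cases "prime (x + y)")
  case True
  then show ?thesis
    by (auto simp: subprime_step_def subprime_next_def)
next
  case False
  define p where "p = smallest_prime_factor (x + y)"
  have "x + y \<noteq> 1" using assms by simp
  then obtain d where "prime d \<and> d dvd x + y" using prime_factor_nat by blast
  then have p: "prime p \<and> p dvd x + y"
    unfolding p_def smallest_prime_factor_def by (rule LeastI)
  have min: "p \<le> d" if "prime d" "d dvd x + y" for d
    unfolding p_def smallest_prime_factor_def using that by (intro Least_le) simp
  obtain z where z: "x + y = p * z" using p by blast
  have "z \<noteq> 1" using z p False by auto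
  then obtain d where d: "prime d" "d dvd z" using prime_factor_nat by blast
  have "z > 0" using z assms by (cases z) auto
  then have "d \<le> z" using d by (simp add: dvd_imp_le)
  moreover have "p \<le> d" using min[of d] d z by simp
  ultimately have "p \<le> z" by simp
  moreover have "subprime_next x y = z"
  proof -
    have "subprime_next x y = (x + y) div p"
      using False by (simp add: subprime_next_def p_def Let_def)
    then show ?thesis using z p prime_gt_0_nat[of p] by simp
  qed
  ultimately show ?thesis
    using p z min by (auto simp: subprime_step_def)
qed

lemma subprime_step_ge_2: "subprime_step p x y z \<Longrightarrow> z \<ge> 2"
  unfolding subprime_step_def using prime_ge_2_nat order_trans by blast

lemma subprime_step_mult: "subprime_step p x y z \<Longrightarrow> p * z = x + y"
  by (simp add: subprime_step_def)

lemma subprime_step_1: "subprime_step 1 x y z \<Longrightarrow> prime z"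
  by (auto simp: subprime_step_def)

lemma subprime_step_le_prime:
  "subprime_step p x y z \<Longrightarrow> prime d \<Longrightarrow> d dvd x + y \<Longrightarrow> p \<noteq> 1 \<Longrightarrow> p \<le> d"
  by (auto simp: subprime_step_def)

lemma subprime_step_quotient: "subprime_step p x y z \<Longrightarrow> p = 1 \<or> prime p"
  by (auto simp: subprime_step_def)

text \<open>The bounds make the sum at least 4, so being even it is composite with smallest prime
  factor 2.\<close>

lemma subprime_step_even:
  assumes "subprime_step p x y z" "even (x + y)" "x \<ge> 2" "y \<ge> 2"
  shows "p = 2"
proof -
  have "p \<noteq> 1"
  proof
    assume "p = 1"
    then have "prime (x + y)"
      using assms(1) by (auto simp: subprime_step_def)
    then show False
      using prime_odd_nat[of "x + y"] assms by auto
  qed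
  moreover have "p \<le> 2"
    using subprime_step_le_prime[OF assms(1) two_is_prime_nat assms(2)] calculation by simp
  moreover have "p \<ge> 2"
    using subprime_step_quotient[OF assms(1)] calculation prime_ge_2_nat by blast
  ultimately show ?thesis by simp
qed

lemma subprime_step_odd:
  assumes "subprime_step p x y z" "odd (x + y)"
  shows "odd p \<and> odd z"
  using subprime_step_mult[OF assms(1)] assms(2) by (metis even_mult_iff)

lemma odd_quotient_cases:
  assumes "subprime_step p x y z" "odd p"
  shows "p = 1 \<or> p \<ge> 3"
  using assms by (cases "p = 0 \<or> p = 2") (auto dest!: subprime_step_quotient)

section \<open>Cycles with one even term\<close>

lemma no_cycle_one_even:
  assumes s: "subprime_step p a0 a1 a2" "subprime_step 2 a1 a2 a3" "subprime_step 2 a2 a3 a4"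
    "subprime_step 2 a3 a4 a5" "subprime_step 2 a4 a5 a0" "subprime_step q a5 a0 a1"
    and odd: "odd p" "odd q"
  shows False
proof -
  note m = s[THEN subprime_step_mult, THEN arg_cong[where f = int], simplified]
  define P Q u v where "P = int p" and "Q = int q" and "u = int a0" and "v = int a1"
  have pos: "u > 0" "v > 0"
    using s[THEN subprime_step_ge_2] by (simp_all add: u_def v_def)
  have P: "P > 0" "Q > 0" using odd by (auto simp: P_def Q_def intro!: Nat.gr0I)
  have e2: "P * int a2 = u + v" and e3: "2 * int a3 = v + int a2"
    and e4: "2 * int a4 = int a2 + int a3" and e5: "2 * int a5 = int a3 + int a4"
    and e0: "2 * u = int a4 + int a5" and e1: "Q * v = int a5 + u"
    using m by (simp_all add: P_def Q_def u_def v_def)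
  \<comment> \<open>Eliminating the other four terms leaves two homogeneous relations between
    \<open>u\<close> and \<open>v\<close>. Multiplying them and cancelling \<open>u * v\<close>
    makes the determinant vanish.\<close>
  have A: "(16 * P - 11) * u = (11 + 5 * P) * v"
    using e2 e3 e4 e5 e0 by algebra
  have B: "(8 * P * Q - 5 - 3 * P) * v = (5 + 8 * P) * u"
    using e2 e3 e4 e5 e1 by algebra
  have "(8 * P * (16 * P * Q - 11 * P - 11 * Q - 20)) * (u * v) = 0"
    using A B by algebra
  then have "16 * P * Q - 11 * P - 11 * Q - 20 = 0" using pos P by simp
  \<comment> \<open>Multiplying by 16 completes the product, with 441 = 16 * 20 + 121. A quotient 1
    gives the factor 5, which does not divide 441; otherwise both factors are at least 37.\<close>
  then have E: "(16 * P - 11) * (16 * Q - 11) = 441" by algebra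
  have "p = 1 \<or> p \<ge> 3" "q = 1 \<or> q \<ge> 3" using odd_quotient_cases s odd by blast+
  then consider "P = 1" | "Q = 1" | "P \<ge> 3" "Q \<ge> 3" by (auto simp: P_def Q_def)
  then show False
  proof cases
    case 1
    have "5 * (16 * Q - 11) = 441" using E unfolding 1 by simp
    then show False by presburger
  next
    case 2
    have "(16 * P - 11) * 5 = 441" using E unfolding 2 by simp
    then show False by presburger
  next
    case 3
    then have "37 * 37 \<le> (16 * P - 11) * (16 * Q - 11)" by (intro mult_mono) auto
    then show False using E by simp
  qed
qed

section \<open>Integer solutions of the determinant equation\<close>

text \<open>Refutes the determinant equation when no quotient is 1. After shifting the variables by
  3, the difference of the two sides has no negative coefficient and a positive constant
  term.\<close>

lemma quotient_equation_all_ge_3: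
  fixes p q r s :: int
  assumes "p \<ge> 3" "q \<ge> 3" "r \<ge> 3" "s \<ge> 3"
  shows "4 * p * q * r * s > 8 + 3 * (p + q + r + s) + 3 * p * q + 3 * r * s + p * r + q * s"
proof -
  define a b c d where "a = p - 3" "b = q - 3" "c = r - 3" "d = s - 3"
  then have eq: "p = a + 3" "q = b + 3" "r = c + 3" "s = d + 3" by auto
  have "a \<ge> 0" "b \<ge> 0" "c \<ge> 0" "d \<ge> 0" using assms a_b_c_d_def by auto
  then show ?thesis
    unfolding eq by (simp add: algebra_simps add_pos_nonneg)
qed

text \<open>The same shift for the determinant equation with \<open>p = 1\<close>; it shows that a
  further quotient must be 1.\<close>

lemma quotient_equation_three_ge_3:
  fixes q r s :: int
  assumes "q \<ge> 3" "r \<ge> 3" "s \<ge> 3"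
  shows "4 * q * r * s > 11 + 6 * q + 4 * r + 3 * s + 3 * r * s + q * s"
proof -
  define b c d where "b = q - 3" "c = r - 3" "d = s - 3"
  then have eq: "q = b + 3" "r = c + 3" "s = d + 3" by auto
  have "b \<ge> 0" "c \<ge> 0" "d \<ge> 0" using assms b_c_d_def by auto
  then show ?thesis
    unfolding eq by (simp add: algebra_simps add_pos_nonneg)
qed

lemma factor_bounds:
  fixes x y n :: int
  assumes "x * y = n" "x > 0" "n > 0"
  shows "y > 0" "x \<le> n"
proof -
  show y: "y > 0" using assms zero_less_mult_pos[of x y] by blast
  have "x * 1 \<le> x * y" using y assms by (intro mult_left_mono) auto
  then show "x \<le> n" using assms by simp
qed

lemma factors_9:
  fixes x y :: int
  assumes "x * y = 9" "x > 0"
  shows "x = 1 \<and> y = 9 \<or> x = 3 \<and> y = 3 \<or> x = 9 \<and> y = 1"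
proof -
  have "x \<le> 9" using factor_bounds[OF assms] by simp
  then have "x = 1 \<or> x = 2 \<or> x = 3 \<or> x = 4 \<or> x = 5 \<or> x = 6 \<or> x = 7 \<or> x = 8 \<or> x = 9"
    using assms(2) by presburger
  then show ?thesis using assms(1) by (elim disjE; hypsubst; presburger)
qed

lemma factors_33:
  fixes x y :: int
  assumes "x * y = 33" "x > 0"
  shows "x = 1 \<and> y = 33 \<or> x = 3 \<and> y = 11 \<or> x = 11 \<and> y = 3 \<or> x = 33 \<and> y = 1"
proof -
  have small: "x = 1 \<and> y = 33 \<or> x = 3 \<and> y = 11" if "x * y = 33" "x > 0" "x \<le> 5" for x y :: int
  proof -
    have "x = 1 \<or> x = 2 \<or> x = 3 \<or> x = 4 \<or> x = 5" using that(2,3) by presburger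
    then show ?thesis using that(1) by (elim disjE; hypsubst; presburger)
  qed
  have "y > 0" using factor_bounds(1)[OF assms] by simp
  have "x \<le> 5 \<or> y \<le> 5"
  proof (rule ccontr)
    assume "\<not> (x \<le> 5 \<or> y \<le> 5)"
    then have "6 * 6 \<le> x * y" by (intro mult_mono) auto
    then show False using assms(1) by simp
  qed
  then show ?thesis
    using small[OF assms] small[of y x] \<open>y > 0\<close> assms(1) by (auto simp: mult.commute)
qed

lemma factors_105:
  fixes q r :: int
  assumes f: "(4 * q - 7) * (4 * r - 7) = 105" and q: "q \<ge> 3" and r: "r = 1 \<or> r \<ge> 3"
  shows "q = 3 \<and> r = 7 \<or> q = 7 \<and> r = 3"
proof -
  have "4 * r - 7 > 0" using factor_bounds(1)[OF f] q by simp
  \<comment> \<open>For \<open>r = 1\<close> the factor would be -3. So it is at least 5, which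
    leaves at most 21 for the other factor.\<close>
  then have "r \<ge> 3" using r by linarith
  then have "(4 * q - 7) * 5 \<le> (4 * q - 7) * (4 * r - 7)"
    using q by (intro mult_left_mono) simp_all
  then have "q \<le> 7" unfolding f by simp
  then have "q = 3 \<or> q = 4 \<or> q = 5 \<or> q = 6 \<or> q = 7" using q by presburger
  then show ?thesis using f by (elim disjE; hypsubst; presburger)
qed

text \<open>This is the determinant equation with \<open>p = 1\<close>. Some further quotient is 1,
  and inserting it turns the equation into a product equal to 33, 9 or 105. The composite value 15
  would only add (1,7,15) and (1,15,7).\<close>

lemma quotient_equation_solutions:
  fixes q r s :: int
  assumes E: "4 * q * r * s = 11 + 6 * q + 4 * r + 3 * s + 3 * r * s + q * s"
    and "q = 1 \<or> q \<ge> 3" "r = 1 \<or> r \<ge> 3" "s = 1 \<or> s \<ge> 3"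
    and not15: "r \<noteq> 15" "s \<noteq> 15"
  shows "(q, r, s) \<in> {(1,5,37), (1,37,5), (3,1,11), (11,1,3), (5,1,5), (3,7,1), (7,3,1)}"
proof -
  consider "q = 1" | "r = 1" "q \<ge> 3" | "s = 1" "q \<ge> 3" | "q \<ge> 3" "r \<ge> 3" "s \<ge> 3"
    using assms by auto
  then show ?thesis
  proof cases
    case 1
    then have f: "(r - 4) * (s - 4) = 33" using E by (simp add: algebra_simps)
    \<comment> \<open>Excludes two negative factors: \<open>r = 1\<close> and \<open>r = 3\<close>
      would give \<open>s = -7\<close> and \<open>s = -29\<close>.\<close>
    have "r > 4"
    proof (rule ccontr)
      assume "\<not> r > 4"
      then have "r = 1 \<or> r = 3 \<or> r = 4" using assms(3) by presburger
      then show False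
        using f assms(4) by (elim disjE; simp)
    qed
    then have "r - 4 > 0" by simp
    from factors_33[OF f this] show ?thesis using not15 1 by auto
  next
    case 2
    then have f: "(q - 2) * (s - 2) = 9" using E by (simp add: algebra_simps)
    have "q - 2 > 0" using 2 by simp
    from factors_9[OF f this] show ?thesis using 2(1) by auto
  next
    case 3
    then have f: "(4 * q - 7) * (4 * r - 7) = 105" using E by (simp add: algebra_simps)
    show ?thesis using factors_105[OF f 3(2) assms(3)] 3(1) by simp
  next
    case 4
    from quotient_equation_three_ge_3[OF this] have False unfolding E using less_irrefl by blast
    then show ?thesis ..
  qed
qed

section \<open>Cycles with two even terms\<close>

text \<open>The determinant condition, obtained by eliminating everything but \<open>a0\<close> and \<open>a1\<close>.\<close>

lemma quotient_equation:
  assumes s: "subprime_step p a0 a1 a2" "subprime_step 2 a1 a2 a3" "subprime_step q a2 a3 a4"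
    "subprime_step r a3 a4 a5" "subprime_step 2 a4 a5 a0" "subprime_step s a5 a0 a1"
    and odd: "odd p" "odd q" "odd r" "odd s"
  defines "P \<equiv> int p" and "Q \<equiv> int q" and "R \<equiv> int r" and "S \<equiv> int s"
  shows "4 * P * Q * R * S =
    8 + 3 * (P + Q + R + S) + 3 * P * Q + 3 * R * S + P * R + Q * S"
proof -
  note m = s[THEN subprime_step_mult, THEN arg_cong[where f = int], simplified]
  define u v where "u = int a0" and "v = int a1"
  have pos: "u > 0" "v > 0"
    using s[THEN subprime_step_ge_2] by (simp_all add: u_def v_def)
  have P: "P > 0" "Q > 0" "R > 0"
    using odd by (auto simp: P_def Q_def R_def intro!: Nat.gr0I)
  have e2: "P * int a2 = u + v" and e3: "2 * int a3 = v + int a2"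
    and e4: "Q * int a4 = int a2 + int a3" and e5: "R * int a5 = int a3 + int a4"
    and e0: "2 * u = int a4 + int a5" and e1: "S * v = int a5 + u"
    using m by (simp_all add: P_def Q_def R_def S_def u_def v_def)
  \<comment> \<open>The pair \<open>a0\<close>, \<open>a1\<close> determines \<open>a3\<close>,
    \<open>a4\<close>, and these determine \<open>a0\<close>, \<open>a1\<close> by the same formulas
    with \<open>R\<close>, \<open>S\<close> in place of \<open>P\<close>, \<open>Q\<close>.\<close>
  have w: "2 * P * int a3 = u + (1 + P) * v" using e2 e3 by algebra
  have z: "2 * P * Q * int a4 = 3 * u + (3 + P) * v" using e2 e3 e4 by algebra
  have u: "2 * R * u = int a3 + (1 + R) * int a4" using e5 e0 by algebra
  have v: "2 * R * S * v = 3 * int a3 + (3 + R) * int a4" using e5 e0 e1 by algebra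
  have A: "(4 * P * Q * R - Q - 3 - 3 * R) * u = (Q * (1 + P) + (1 + R) * (3 + P)) * v"
    using w z u by algebra
  have B: "(4 * P * Q * R * S - 3 * Q - 3 * P * Q - (3 + R) * (3 + P)) * v
      = (3 * Q + 9 + 3 * R) * u"
    using w z v by algebra
  have "(4 * P * Q * R - Q - 3 - 3 * R) *
          (4 * P * Q * R * S - 3 * Q - 3 * P * Q - (3 + R) * (3 + P)) * (u * v)
      = (Q * (1 + P) + (1 + R) * (3 + P)) * (3 * Q + 9 + 3 * R) * (u * v)"
    using A B by algebra
  then have "(4 * P * Q * R - Q - 3 - 3 * R) *
          (4 * P * Q * R * S - 3 * Q - 3 * P * Q - (3 + R) * (3 + P))
      = (Q * (1 + P) + (1 + R) * (3 + P)) * (3 * Q + 9 + 3 * R)"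
    using pos by simp
  \<comment> \<open>The determinant contains the positive factor \<open>4 * P * Q * R\<close>, which
    cancels.\<close>
  then have "(4 * P * Q * R) * (4 * P * Q * R * S -
    (8 + 3 * (P + Q + R + S) + 3 * P * Q + 3 * R * S + P * R + Q * S)) = 0"
    by algebra
  then show ?thesis using P by simp
qed

lemma not_prime_mult: "d > 1 \<Longrightarrow> e > 1 \<Longrightarrow> \<not> prime (d * e * k :: nat)"
  using prime_product[of d "e * k"] by (auto simp: mult.assoc)

lemma prime_mult_left: "prime (d * k :: nat) \<Longrightarrow> d > 1 \<Longrightarrow> k = 1"
  using prime_product by blast

text \<open>Each numerical solution of the quotient equation fixes the cycle up to a factor.
  It fails because a quotient is not the smallest prime factor, because a term that
  should be prime is not, or because primality of a term forces another term to be \<open>1\<close>.\<close>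

lemma no_cycle_two_even_quotient_1:
  assumes s: "subprime_step 1 a0 a1 a2" "subprime_step 2 a1 a2 a3" "subprime_step q a2 a3 a4"
    "subprime_step r a3 a4 a5" "subprime_step 2 a4 a5 a0" "subprime_step s a5 a0 a1"
    and odd: "odd q" "odd r" "odd s"
  shows False
proof -
  note m = s[THEN subprime_step_mult]
  have "q \<noteq> 15" "r \<noteq> 15" "s \<noteq> 15"
    using s[THEN subprime_step_quotient] prime_product[of 3 5] by auto
  moreover have "q = 1 \<or> q \<ge> 3" "r = 1 \<or> r \<ge> 3" "s = 1 \<or> s \<ge> 3"
    using odd_quotient_cases s odd by blast+
  ultimately have "(int q, int r, int s) \<in>
      {(1,5,37), (1,37,5), (3,1,11), (11,1,3), (5,1,5), (3,7,1), (7,3,1)}"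
    using quotient_equation[OF s] odd
    by (intro quotient_equation_solutions) auto
  then consider "q = 1" "r = 5" "s = 37" | "q = 1" "r = 37" "s = 5" | "q = 3" "r = 1" "s = 11"
    | "q = 11" "r = 1" "s = 3" | "q = 5" "r = 1" "s = 5" | "q = 3" "r = 7" "s = 1"
    | "q = 7" "r = 3" "s = 1"
    by auto
  then show False
  proof cases
    case 1
    then have "a2 = 3 * 9 * a1" using m by simp
    then show False using subprime_step_1[OF s(1)] not_prime_mult[of 3 9 a1] by simp
  next
    case 2
    then have "a4 = 3 * 9 * a5" using m by simp
    then show False using subprime_step_1 s(3) 2 not_prime_mult[of 3 9 a5] by simp
  next
    case 3
    then have "3 * a0 = 14 * a1" using m by simp
    then have "3 dvd a1" by presburger
    \<comment> \<open>Now 3 divides a sum whose smallest prime factor should be 11.\<close>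
    then have "3 dvd a5 + a0" using m(6) by (metis dvd_mult)
    then show False using subprime_step_le_prime[OF s(6), of 3] 3 by simp
  next
    case 4
    then have "3 * a3 = 14 * a4" using m by simp
    then have "3 dvd a4" by presburger
    then have "3 dvd a2 + a3" using m(3) by (metis dvd_mult)
    then show False using subprime_step_le_prime[OF s(3), of 3] 4 by simp
  next
    case 5
    then have "a2 = 3 * a4" using m by simp
    then have "a4 = 1" using subprime_step_1[OF s(1)] prime_mult_left[of 3 a4] by simp
    then show False using subprime_step_ge_2[OF s(3)] by simp
  next
    case 6
    then have "a2 = 5 * a5" using m by simp
    then have "a5 = 1" using subprime_step_1[OF s(1)] prime_mult_left[of 5 a5] by simp
    then show False using subprime_step_ge_2[OF s(4)] by simp
  next
    case 7
    then have "5 * a5 = 7 * a4" using m by simp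
    then have "5 dvd a4" by presburger
    then have "5 dvd a2 + a3" using m(3) by (metis dvd_mult)
    then show False using subprime_step_le_prime[OF s(3), of 5] 7 by simp
  qed
qed

text \<open>Exchanging \<open>p\<close> with \<open>q\<close> and \<open>r\<close> with
  \<open>s\<close> preserves the determinant equation, so the solutions for \<open>p = 1\<close>
  apply to \<open>(p, s, r)\<close>. As \<open>p\<close> and \<open>r\<close> differ from 1, only
  those with \<open>s = 1\<close> remain, and then \<open>a1\<close> is prime.\<close>

lemma no_cycle_two_even_quotient_2:
  assumes s: "subprime_step p a0 a1 a2" "subprime_step 2 a1 a2 a3" "subprime_step 1 a2 a3 a4"
    "subprime_step r a3 a4 a5" "subprime_step 2 a4 a5 a0" "subprime_step s a5 a0 a1"
    and odd: "odd p" "odd r" "odd s"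
    and "p \<noteq> 1" "r \<noteq> 1"
  shows False
proof -
  note m = s[THEN subprime_step_mult]
  have "p \<noteq> 15" "r \<noteq> 15" "s \<noteq> 15"
    using s[THEN subprime_step_quotient] prime_product[of 3 5] by auto
  moreover have "p = 1 \<or> p \<ge> 3" "r = 1 \<or> r \<ge> 3" "s = 1 \<or> s \<ge> 3"
    using odd_quotient_cases s odd by blast+
  ultimately have "(int p, int s, int r) \<in>
      {(1,5,37), (1,37,5), (3,1,11), (11,1,3), (5,1,5), (3,7,1), (7,3,1)}"
    using quotient_equation[OF s] odd
    by (intro quotient_equation_solutions) (auto simp: algebra_simps)
  then consider "p = 3" "s = 1" "r = 11" | "p = 11" "s = 1" "r = 3" | "p = 5" "s = 1" "r = 5"
    using assms by auto
  then show False
  proof cases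
    case 1
    then have "a1 = 5 * a5" using m by simp
    then have "a5 = 1" using subprime_step_1 s(6) 1 prime_mult_left[of 5 a5] by simp
    then show False using subprime_step_ge_2[OF s(4)] by simp
  next
    case 2
    then have "a1 = 7 * a2" using m by simp
    then have "a2 = 1" using subprime_step_1 s(6) 2 prime_mult_left[of 7 a2] by simp
    then show False using subprime_step_ge_2[OF s(1)] by simp
  next
    case 3
    then have "a1 = 3 * a2" using m by simp
    then have "a2 = 1" using subprime_step_1 s(6) 3 prime_mult_left[of 3 a2] by simp
    then show False using subprime_step_ge_2[OF s(1)] by simp
  qed
qed

text \<open>Rotation by three places turns \<open>(p, q, r, s)\<close> into
  \<open>(r, s, p, q)\<close>, so each of the two preceding lemmas excludes two quotients from being
  1. Then all are at least 3.\<close>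

lemma no_cycle_two_even:
  assumes s: "subprime_step p a0 a1 a2" "subprime_step 2 a1 a2 a3" "subprime_step q a2 a3 a4"
    "subprime_step r a3 a4 a5" "subprime_step 2 a4 a5 a0" "subprime_step s a5 a0 a1"
    and odd: "odd p" "odd q" "odd r" "odd s"
  shows False
proof -
  have "p \<noteq> 1"
    using no_cycle_two_even_quotient_1 s odd by blast
  moreover have "r \<noteq> 1"
    using no_cycle_two_even_quotient_1[OF _ s(5,6,1,2,3)] s(4) odd by blast
  moreover have "q \<noteq> 1"
    using no_cycle_two_even_quotient_2[OF s(1,2) _ s(4,5,6)] s(3) odd calculation by blast
  moreover have "s \<noteq> 1"
    using no_cycle_two_even_quotient_2[OF s(4,5) _ s(1,2,3)] s(6) odd calculation by blast
  ultimately have "p \<ge> 3" "q \<ge> 3" "r \<ge> 3" "s \<ge> 3"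
    using odd_quotient_cases s odd by blast+
  then show False
    using quotient_equation[OF s odd] quotient_equation_all_ge_3[of "int p" "int q" "int r" "int s"]
    by simp
qed

section \<open>Parity patterns and conclusion\<close>

lemma no_cycle_even_odd:
  assumes s: "subprime_step p0 a0 a1 a2" "subprime_step p1 a1 a2 a3" "subprime_step p2 a2 a3 a4"
    "subprime_step p3 a3 a4 a5" "subprime_step p4 a4 a5 a0" "subprime_step p5 a5 a0 a1"
    and a0: "even a0" and a1: "odd a1"
  shows False
proof -
  note even = subprime_step_even[OF _ _ subprime_step_ge_2 subprime_step_ge_2]
  \<comment> \<open>Two adjacent even terms make the term before them even, since
    \<open>x = p * z - y\<close>. An even \<open>a5\<close> would thus force \<open>a1\<close> to be
    even.\<close>
  have even_back: "even x" if "subprime_step p x y z" "even y" "even z" for p x y z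
    using subprime_step_mult[OF that(1)] that by (metis even_add even_mult_iff)
  have "odd a5"
  proof
    assume "even a5"
    then have "even a4" using even_back[OF s(5)] a0 by blast
    then have "even a3" using even_back[OF s(4)] \<open>even a5\<close> by blast
    then have "even a2" using even_back[OF s(3)] \<open>even a4\<close> by blast
    then show False using even_back[OF s(2)] \<open>even a3\<close> a1 by blast
  qed
  have a2: "odd p0" "odd a2" using subprime_step_odd[OF s(1)] a0 a1 by auto
  have p5: "odd p5" using subprime_step_odd[OF s(6)] a0 \<open>odd a5\<close> by auto
  have p1: "p1 = 2" using even[OF s(2) _ s(6) s(1)] a1 a2 by simp
  show False
  proof (cases "even a3")
    case True
    then have "odd p2" "odd a4" using subprime_step_odd[OF s(3)] a2 by auto
    moreover have "odd p3" using subprime_step_odd[OF s(4)] True \<open>odd a4\<close> by auto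
    moreover have "p4 = 2" using even[OF s(5) _ s(3) s(4)] \<open>odd a4\<close> \<open>odd a5\<close> by simp
    ultimately show False
      using no_cycle_two_even s a2 p1 p5 by blast
  next
    case False
    have p2: "p2 = 2" using even[OF s(3) _ s(1) s(2)] a2 False by simp
    \<comment> \<open>An even \<open>a4\<close> would make \<open>a4 + a5\<close> odd, and hence
      \<open>a0\<close> odd.\<close>
    have "odd a4"
      using subprime_step_odd[OF s(5)] \<open>odd a5\<close> a0 by auto
    then have "p3 = 2" "p4 = 2"
      using even[OF s(4) _ s(2) s(3)] even[OF s(5) _ s(3) s(4)] False \<open>odd a5\<close> by simp_all
    then show False
      using no_cycle_one_even s a2 p1 p2 p5 by blast
  qed
qed

lemma cycle_constant:
  assumes s: "subprime_step p0 a0 a1 a2" "subprime_step p1 a1 a2 a3" "subprime_step p2 a2 a3 a4"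
    "subprime_step p3 a3 a4 a5" "subprime_step p4 a4 a5 a0" "subprime_step p5 a5 a0 a1"
  shows "a1 = a0 \<and> a2 = a0 \<and> a3 = a0 \<and> a4 = a0 \<and> a5 = a0"
proof -
  note even = subprime_step_even[OF _ _ subprime_step_ge_2 subprime_step_ge_2]
  have "even a0 \<longrightarrow> even a1" using no_cycle_even_odd[OF s] by blast
  moreover have "even a1 \<longrightarrow> even a2" using no_cycle_even_odd[OF s(2-6,1)] by blast
  moreover have "even a2 \<longrightarrow> even a3" using no_cycle_even_odd[OF s(3-6,1-2)] by blast
  moreover have "even a3 \<longrightarrow> even a4" using no_cycle_even_odd[OF s(4-6,1-3)] by blast
  moreover have "even a4 \<longrightarrow> even a5" using no_cycle_even_odd[OF s(5-6,1-4)] by blast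
  moreover have "even a5 \<longrightarrow> even a0" using no_cycle_even_odd[OF s(6,1-5)] by blast
  ultimately have "p0 = 2" "p1 = 2" "p2 = 2" "p3 = 2" "p4 = 2" "p5 = 2"
    using even[OF s(1) _ s(5,6)] even[OF s(2) _ s(6,1)] even[OF s(3) _ s(1,2)]
      even[OF s(4) _ s(2,3)] even[OF s(5) _ s(3,4)] even[OF s(6) _ s(4,5)] by auto
  \<comment> \<open>Each term is the mean of the two before it, and cyclically only constants
    satisfy this.\<close>
  then show ?thesis
    using s[THEN subprime_step_mult] by simp
qed

theorem theorem14:
  shows "\<not> (\<exists>t. nontrivial_subprime_cycle 6 t)"
proof
  assume "\<exists>t. nontrivial_subprime_cycle 6 t"
  then obtain t where len: "length t = 6" and pos: "\<forall>x\<in>set t. x > 0"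
    and rec: "\<And>i. t ! ((i + 2) mod 6) = subprime_next (t ! (i mod 6)) (t ! ((i + 1) mod 6))"
    and neq: "\<exists>x\<in>set t. \<exists>y\<in>set t. x \<noteq> y"
    by (auto simp: nontrivial_subprime_cycle_def)
  have pos: "t ! (i mod 6) > 0" for i
    using pos len by simp
  have step: "\<exists>p. subprime_step p (t ! (i mod 6)) (t ! ((i + 1) mod 6)) (t ! ((i + 2) mod 6))" for i
    unfolding rec by (intro subprime_step_subprime_next pos)
  have "t ! 1 = t ! 0 \<and> t ! 2 = t ! 0 \<and> t ! 3 = t ! 0 \<and> t ! 4 = t ! 0 \<and> t ! 5 = t ! 0"
    using step[of 0] step[of 1] step[of 2] step[of 3] step[of 4] step[of 5] cycle_constant
    by (simp add: numeral_2_eq_2[symmetric]) blast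
  moreover have "i = 0 \<or> i = 1 \<or> i = 2 \<or> i = 3 \<or> i = 4 \<or> i = 5" if "i < 6" for i :: nat
    using that by presburger
  ultimately have "t ! i = t ! 0" if "i < 6" for i
    using that by metis
  then have "x = t ! 0" if "x \<in> set t" for x
    using that unfolding in_set_conv_nth len by blast
  then show False using neq by blast
qed

end
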